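(* Let $d$ be a positive integer and $\varepsilon>0$, and set $n=n^{\mathrm{bms}}(d,\varepsilon)$. Let $X_1,X_2,\ldots,X_{(n-1)d+1}$ be sets in $\mathbb{R}^d$ such that $B_1(0)\subset\bigcap_{i=1}^{(n-1)d+1}\operatorname{conv}X_i$. Then one can choose $x_1\in X_1,x_2\in X_2,\ldots,x_{(n-1)d+1}\in X_{(n-1)d+1}$ such that $$B_{1/(1+\varepsilon)}(0)\subset\operatorname{conv}\{x_1,x_2,\ldots,x_{(n-1)d+1}\}.$$
   Context: $B_r(p)\subset\mathbb{R}^d$ denotes the closed Euclidean ball of radius $r$ with center $p$. For a positive integer $d$ and $\varepsilon>0$, $n^{\mathrm{bms}}(d,\varepsilon)$ denotes the smallest integer such that, for any compact convex set $K\subset\mathbb{R}^d$ that is centrally symmetric about the origin, has positive volume and has $C^2$ boundary, there is a polytope $P$ with at most $n^{\mathrm{bms}}(d,\varepsilon)$ vertices and an invertible linear transformation $\lambda:\mathbb{R}^d\to\mathbb{R}^d$ such that $P\subset\lambda(K)\subset(1+\varepsilon)P$, where $(1+\varepsilon)P=\{(1+\varepsilon)x:x\in P\}$. A polytope is the convex hull of finitely many points; $\operatorname{conv}$ is the convex hull. *)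

theory Defs
  imports "HOL-Analysis.Analysis"
begin

text \<open>\<open>G\<close> is the gradient of \<open>g\<close> and \<open>H\<close> the derivative of \<open>G\<close> (the Hessian of \<open>g\<close>).\<close>

definition C2_on :: "'a::euclidean_space set \<Rightarrow> ('a \<Rightarrow> real) \<Rightarrow> ('a \<Rightarrow> 'a) \<Rightarrow> ('a \<Rightarrow> 'a \<Rightarrow>\<^sub>L 'a) \<Rightarrow> bool"
  where "C2_on U g G H \<longleftrightarrow>
    (\<forall>x\<in>U. GDERIV g x :> G x) \<and>
    (\<forall>x\<in>U. (G has_derivative blinfun_apply (H x)) (at x)) \<and>
    continuous_on U H"

text \<open>The boundary of \<open>K\<close> is a hypersurface of class $C^2$: near each of its points it is the zero
  set of a $C^2$ function with nowhere vanishing gradient.\<close>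

definition C2_boundary :: "'a::euclidean_space set \<Rightarrow> bool"
  where "C2_boundary K \<longleftrightarrow>
    (\<forall>p\<in>frontier K. \<exists>U g G H. open U \<and> p \<in> U \<and> C2_on U g G H \<and>
       (\<forall>x\<in>U. G x \<noteq> 0) \<and> frontier K \<inter> U = {x\<in>U. g x = 0})"

definition smooth_symmetric_body :: "'a::euclidean_space set \<Rightarrow> bool"
  where "smooth_symmetric_body K \<longleftrightarrow>
    compact K \<and> convex K \<and> (\<forall>x\<in>K. - x \<in> K) \<and> measure lebesgue K > 0 \<and> C2_boundary K"

text \<open>The dimension \<open>d\<close> is passed as the index type \<open>'n\<close> with \<open>d = CARD('n)\<close>.\<close>

definition n_bms :: "'n::finite itself \<Rightarrow> real \<Rightarrow> nat"
  where "n_bms TYPE('n) \<epsilon> = (LEAST n.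
    \<forall>K :: (real ^ 'n) set. smooth_symmetric_body K \<longrightarrow>
      (\<exists>(P :: (real ^ 'n) set) (f :: real ^ 'n \<Rightarrow> real ^ 'n).
         polytope P \<and> card {v. v extreme_point_of P} \<le> n \<and>
         linear f \<and> bij f \<and>
         P \<subseteq> f ` K \<and> f ` K \<subseteq> (\<lambda>x. (1 + \<epsilon>) *\<^sub>R x) ` P))"

end

theory Submission
  imports Defs
begin

text \<open>Let \<open>V\<close> be the set of at most \<open>n\<close> vertices of a polytope between the balls of radius
  \<open>1/(1+\<epsilon>)\<close> and \<open>1\<close>. Some \<open>a \<in> X\<^sub>1\<close> has norm at least \<open>1\<close>, and after a rotation \<open>V\<close> contains a
  point of the segment from \<open>0\<close> to \<open>a\<close>. Replacing that vertex by \<open>a\<close> only enlarges the polytope,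
  because \<open>0\<close> lies in it. Each of the other \<open>n - 1\<close> vertices is put in the convex hull of \<open>a\<close> and
  one point from each of \<open>d\<close> further sets by Barany's colourful Caratheodory theorem with one
  prescribed point; these blocks of \<open>d\<close> sets are disjoint.

  The minimum that defines \<open>n\<close> is attained because a vector family in \<open>K\<close> of maximal determinant
  places \<open>K\<close> between two balls whose radii depend only on \<open>d\<close>, and between those a finite net of
  the larger ball bounds the number of vertices needed.\<close>

section \<open>Colourful Caratheodory theorem with one prescribed point\<close>

lemma convex_cone_hull_rangeE:
  fixes y :: "'i::finite \<Rightarrow> 'a::euclidean_space"
  assumes "z \<in> convex_cone hull (range y)"
  obtains l where "\<And>i. 0 \<le> l i" "z = (\<Sum>i\<in>UNIV. l i *\<^sub>R y i)"
proof -
  let ?C = "{(\<Sum>i\<in>UNIV. l i *\<^sub>R y i) | l. \<forall>i. 0 \<le> (l i :: real)}"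
  have "convex_cone hull (range y) \<subseteq> ?C"
  proof (rule hull_minimal)
    show "range y \<subseteq> ?C"
    proof clarify
      fix k
      have "y k = (\<Sum>i\<in>UNIV. (if i = k then 1 else 0) *\<^sub>R y i)"
        by (simp add: if_distrib[of "\<lambda>t. t *\<^sub>R _"] cong: if_cong)
      then show "\<exists>l. y k = (\<Sum>i\<in>UNIV. l i *\<^sub>R y i) \<and> (\<forall>i. 0 \<le> (l i :: real))"
        by (intro exI[of _ "\<lambda>i. if i = k then 1 else 0"]) auto
    qed
    show "convex_cone ?C"
      unfolding convex_cone_iff
    proof (intro conjI ballI allI impI)
      show "0 \<in> ?C" by (auto intro!: exI[of _ "\<lambda>_. 0"])
    next
      fix x x' assume "x \<in> ?C" "x' \<in> ?C"
      then obtain l l' where "x = (\<Sum>i\<in>UNIV. l i *\<^sub>R y i)" "\<forall>i. 0 \<le> (l i :: real)"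
        "x' = (\<Sum>i\<in>UNIV. l' i *\<^sub>R y i)" "\<forall>i. 0 \<le> (l' i :: real)" by auto
      then show "x + x' \<in> ?C"
        by (auto intro!: exI[of _ "\<lambda>i. l i + l' i"] simp: scaleR_left_distrib sum.distrib)
    next
      fix x and c :: real assume "x \<in> ?C" "0 \<le> c"
      then obtain l where "x = (\<Sum>i\<in>UNIV. l i *\<^sub>R y i)" "\<forall>i. 0 \<le> (l i :: real)" by auto
      with \<open>0 \<le> c\<close> show "c *\<^sub>R x \<in> ?C"
        by (auto intro!: exI[of _ "\<lambda>i. c * l i"] simp: scaleR_sum_right)
    qed
  qed
  with assms that show ?thesis by blast
qed

text \<open>The square matrix with rows \<open>y i\<close> annihilates \<open>u\<close>, so it is
  singular and its rows are dependent. A change of sign, if necessary, makes some coefficient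
  positive, as the later ratio test requires.\<close>

lemma orthogonal_family_dependent:
  fixes y :: "'n::finite \<Rightarrow> real ^ 'n"
  assumes "u \<noteq> 0" and "\<And>i. u \<bullet> y i = 0"
  obtains m where "(\<Sum>i\<in>UNIV. m i *\<^sub>R y i) = 0" "\<exists>i. m i > 0"
proof -
  define A :: "real ^ 'n ^ 'n" where "A = (\<chi> i. y i)"
  have "A *v u = 0"
    using assms(2) by (simp add: A_def matrix_vector_mult_def vec_eq_iff inner_vec_def mult.commute)
  then have "\<not> (\<exists>B. B ** A = mat 1)"
    using assms(1) matrix_left_invertible_ker[of A] by blast
  then have "\<not> (\<exists>B. A ** B = mat 1)"
    using matrix_left_right_inverse by blast
  then obtain c i where c: "(\<Sum>i\<in>UNIV. c i *s row i A) = 0" "c i \<noteq> 0"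
    unfolding matrix_right_invertible_independent_rows by blast
  have "row j A = y j" for j
    by (simp add: row_def A_def)
  with c(1) have c1: "(\<Sum>i\<in>UNIV. c i *\<^sub>R y i) = 0"
    by (simp add: scalar_mult_eq_scaleR)
  show thesis
  proof (cases "c i > 0")
    case True
    with c1 that show ?thesis by blast
  next
    case False
    with c(2) have "- c i > 0" by simp
    moreover have "(\<Sum>i\<in>UNIV. (- c i) *\<^sub>R y i) = 0"
      using c1 by (simp add: sum_negf)
    ultimately show ?thesis using that[of "\<lambda>i. - c i"] by blast
  qed
qed

text \<open>If no \<open>l i\<close> vanishes, every \<open>y i\<close> is orthogonal to
  \<open>u\<close>, so the family is dependent. Subtracting a multiple of the dependency keeps the
  sum and removes one coefficient.\<close>

lemma conic_caratheodory_hyperplane: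
  fixes y :: "'n::finite \<Rightarrow> real ^ 'n"
  assumes "u \<noteq> 0" and "\<And>i. l i * (u \<bullet> y i) = 0" and l: "\<And>i. 0 \<le> l i"
  obtains l' k where "\<And>i. 0 \<le> l' i" "l' k = 0"
    "(\<Sum>i\<in>UNIV. l' i *\<^sub>R y i) = (\<Sum>i\<in>UNIV. l i *\<^sub>R y i)"
proof (cases "\<exists>k. l k = 0")
  case True
  with that l show ?thesis by metis
next
  case False
  with assms(2) have "\<And>i. u \<bullet> y i = 0" by simp
  with assms(1) obtain m where m: "(\<Sum>i\<in>UNIV. m i *\<^sub>R y i) = 0" "\<exists>i. m i > 0"
    using orthogonal_family_dependent by metis
  \<comment> \<open>Ratio test: \<open>l k / m k\<close> is the largest multiple of \<open>m\<close>
    that can be subtracted before a coefficient becomes negative; indices with \<open>m i\<close>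
    \<le> 0 impose no bound.\<close>
  define k where "k = arg_min_on (\<lambda>i. l i / m i) {i. m i > 0}"
  have k: "m k > 0" "\<And>i. m i > 0 \<Longrightarrow> l k / m k \<le> l i / m i"
    using arg_min_if_finite(1)[of "{i. m i > 0}" "\<lambda>i. l i / m i"]
      arg_min_least[of "{i. m i > 0}" _ "\<lambda>i. l i / m i"] m(2)
    unfolding k_def by auto
  let ?l = "\<lambda>i. l i - l k / m k * m i"
  show ?thesis
  proof (rule that[of ?l k])
    fix i
    show "0 \<le> ?l i"
    proof (cases "m i > 0")
      case True
      with k(2)[OF True] show ?thesis by (simp add: pos_le_divide_eq)
    next
      case False
      have "l k / m k \<ge> 0" using l k(1) by simp
      with False have "l k / m k * m i \<le> 0" by (simp only: mult_nonneg_nonpos not_less)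
      with l[of i] show ?thesis by linarith
    qed
  next
    show "?l k = 0" using k(1) by simp
  next
    have "(\<Sum>i\<in>UNIV. ?l i *\<^sub>R y i)
        = (\<Sum>i\<in>UNIV. l i *\<^sub>R y i) - (l k / m k) *\<^sub>R (\<Sum>i\<in>UNIV. m i *\<^sub>R y i)"
      by (simp add: scaleR_left_diff_distrib sum_subtractf scaleR_sum_right)
    with m(1) show "(\<Sum>i\<in>UNIV. ?l i *\<^sub>R y i) = (\<Sum>i\<in>UNIV. l i *\<^sub>R y i)" by simp
  qed
qed

lemma sum_in_convex_cone:
  assumes "convex_cone C" and "\<And>i. i \<in> I \<Longrightarrow> f i \<in> C"
  shows "sum f I \<in> C"
  using assms(2)
  by (induction I rule: infinite_finite_induct)
    (auto intro: convex_cone_add[OF assms(1)] convex_cone_contains_0[OF assms(1)])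

lemma colourful_cone:
  fixes Y :: "'n::finite \<Rightarrow> (real ^ 'n) set" and q :: "real ^ 'n"
  assumes fin: "\<And>i. finite (Y i)"
    and pos: "\<And>i u. u \<noteq> 0 \<Longrightarrow> \<exists>y\<in>Y i. u \<bullet> y > 0"
  obtains y where "\<And>i. y i \<in> Y i" "q \<in> convex_cone hull (range y)"
proof -
  let ?C = "\<lambda>y. convex_cone hull (range y) :: (real ^ 'n) set"
  let ?F = "PiE UNIV Y"
  have ne: "Y i \<noteq> {}" for i
    using pos[of "axis i 1" i] by (auto simp: axis_eq_0_iff)
  have F: "finite ?F" "?F \<noteq> {}"
    using fin ne by (auto simp: PiE_eq_empty_iff intro: finite_PiE)
  txt \<open>A selection whose cone is nearest to \<open>q\<close>: the nearest point needs at most \<open>CARD('n) - 1\<close> generators,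
    so if \<open>q\<close> were outside the cone, exchanging an unused one would bring the cone closer.\<close>
  define y where "y = arg_min_on (\<lambda>y. infdist q (?C y)) ?F"
  have y: "\<And>i. y i \<in> Y i"
    using arg_min_if_finite(1)[OF F] unfolding y_def by (metis PiE_iff UNIV_I)
  have min: "infdist q (?C y) \<le> infdist q (?C y')" if "\<And>i. y' i \<in> Y i" for y'
    unfolding y_def by (rule arg_min_least[OF F]) (use that in auto)
  have closed: "closed (?C y)" for y :: "'n \<Rightarrow> real ^ 'n"
    by (simp add: closed_convex_cone_hull)
  define z where "z = closest_point (?C y) q"
  have z: "z \<in> ?C y"
    unfolding z_def by (rule closest_point_in_set[OF closed convex_cone_hull_nonempty])
  have dz: "infdist q (?C y) = dist q z"
    unfolding z_def infdist_eq_setdist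
    by (rule setdist_closest_point[OF closed convex_cone_hull_nonempty])
  have "q \<in> ?C y"
  proof (rule ccontr)
    assume "q \<notin> ?C y"
    define u where "u = q - z"
    have "u \<noteq> 0" using z \<open>q \<notin> ?C y\<close> by (auto simp: u_def)
    have le: "u \<bullet> (w - z) \<le> 0" if "w \<in> ?C y" for w
      unfolding u_def z_def
      by (rule closest_point_dot[OF convex_convex_cone_hull closed that])
    \<comment> \<open>The projection inequality, tested at 0 and at twice \<open>z\<close>, bounds
      the product from both sides.\<close>
    have "u \<bullet> z = 0"
      using le[OF convex_cone_hull_contains_0] le[OF convex_cone_hull_mul[OF z, of 2]]
      by (simp add: inner_diff_right)
    then have le0: "u \<bullet> w \<le> 0" if "w \<in> ?C y" for w
      using le[OF that] by (simp add: inner_diff_right)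
    obtain l where l: "\<And>i. 0 \<le> l i" "z = (\<Sum>i\<in>UNIV. l i *\<^sub>R y i)"
      using convex_cone_hull_rangeE[OF z] by metis
    \<comment> \<open>Complementary slackness: nonnegative terms with sum 0 all vanish, so only
      generators orthogonal to \<open>u\<close> carry weight in \<open>z\<close>.\<close>
    have "(\<Sum>i\<in>UNIV. - (l i * (u \<bullet> y i))) = 0"
      using \<open>u \<bullet> z = 0\<close> by (simp add: l(2) inner_sum_right sum_negf)
    moreover have "0 \<le> - (l i * (u \<bullet> y i))" for i
      using l(1)[of i] le0[OF hull_inc[of "y i"]] by (simp add: mult_nonneg_nonpos)
    ultimately have "l i * (u \<bullet> y i) = 0" for i
      using sum_nonneg_eq_0_iff[of UNIV "\<lambda>i. - (l i * (u \<bullet> y i))"] by simp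
    then obtain l' k where l': "\<And>i. 0 \<le> l' i" "l' k = 0" "(\<Sum>i\<in>UNIV. l' i *\<^sub>R y i) = z"
      using conic_caratheodory_hyperplane[OF \<open>u \<noteq> 0\<close>, of l y] l by metis
    \<comment> \<open>The index \<open>k\<close> has coefficient 0, so exchanging \<open>y k\<close>
      for \<open>v\<close> keeps \<open>z\<close> in the cone. As \<open>v\<close> points to the
      side of \<open>q\<close>, a short move from \<open>z\<close> along \<open>v\<close> comes
      closer to \<open>q\<close>.\<close>
    obtain v where v: "v \<in> Y k" "u \<bullet> v > 0" using pos[OF \<open>u \<noteq> 0\<close>] by blast
    let ?y = "y(k := v)"
    have zsum: "z = (\<Sum>i\<in>UNIV. l' i *\<^sub>R ?y i)"
      unfolding l'(3)[symmetric] using l'(2) by (intro sum.cong) auto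
    have z': "z \<in> ?C ?y"
      unfolding zsum
    proof (rule sum_in_convex_cone[OF convex_cone_convex_cone_hull])
      show "\<And>i. l' i *\<^sub>R ?y i \<in> ?C ?y"
        by (intro convex_cone_hull_mul hull_inc l'(1)) auto
    qed
    have "v \<in> ?C ?y" by (intro hull_inc) (auto intro: range_eqI[of _ _ k])
    obtain t where t: "t > 0" "dist (z + t *\<^sub>R (z + v - z)) q < dist z q"
      using closer_point_lemma[of q z "z + v"] v(2) by (auto simp: u_def)
    have "z + t *\<^sub>R v \<in> ?C ?y"
      using t(1) by (intro convex_cone_hull_add z' convex_cone_hull_mul \<open>v \<in> ?C ?y\<close>) simp
    then have "infdist q (?C ?y) < dist q z"
      using t(2) infdist_le[of "z + t *\<^sub>R v" "?C ?y" q] by (simp add: dist_commute)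
    moreover have "infdist q (?C y) \<le> infdist q (?C ?y)"
      by (rule min) (use y v in auto)
    ultimately show False using dz by simp
  qed
  with y that show thesis by blast
qed

text \<open>If \<open>p - a\<close> is a nonnegative combination of vectors \<open>s i - p\<close>,
  solving for \<open>p\<close> makes it a convex combination of \<open>a\<close> and the
  \<open>s i\<close>. So the conic version is applied with target \<open>p - a\<close>.\<close>

lemma colourful_caratheodory_fixed_point:
  fixes X :: "'n::finite \<Rightarrow> (real ^ 'n) set" and p a :: "real ^ 'n"
  assumes p: "\<And>i. p \<in> convex hull (X i)"
  obtains x where "\<And>i. x i \<in> X i" "p \<in> convex hull (insert a (range x))"
proof -
  \<comment> \<open>Finite subsets leave only finitely many selections, so a least distance to
    \<open>p\<close> exists.\<close>
  have "\<exists>S. finite S \<and> S \<subseteq> X i \<and> p \<in> convex hull S" for i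
    using p[of i] caratheodory[of "X i"] by auto
  then obtain S where S: "\<And>i. finite (S i)" "\<And>i. S i \<subseteq> X i" "\<And>i. p \<in> convex hull (S i)"
    by metis
  let ?F = "PiE UNIV S"
  let ?H = "\<lambda>x :: 'n \<Rightarrow> real ^ 'n. convex hull (insert a (range x))"
  have "S i \<noteq> {}" for i
    using S(3)[of i] by auto
  then have F: "finite ?F" "?F \<noteq> {}"
    using S(1) by (auto simp: PiE_eq_empty_iff intro: finite_PiE)
  txt \<open>Moving the points of each \<open>S i\<close> by less than the least positive distance \<open>d\<close> puts \<open>p\<close> in the
    interior of every hull, where the conic version applies.\<close>
  have "\<exists>x\<in>?F. p \<in> ?H x"
  proof (rule ccontr)
    assume neg: "\<not> (\<exists>x\<in>?F. p \<in> ?H x)"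
    define d where "d = Min ((\<lambda>x. infdist p (?H x)) ` ?F)"
    have "closed (?H x)" for x
      by (simp add: compact_imp_closed finite_imp_compact_convex_hull)
    then have "infdist p (?H x) > 0" if "x \<in> ?F" for x
      using infdist_pos_not_in_closed[of "?H x" p] neg that by auto
    then have "d > 0" unfolding d_def using F by (subst Min_gr_iff) auto
    have dmin: "d \<le> infdist p (?H x)" if "x \<in> ?F" for x
      unfolding d_def using F that by (intro Min_le) auto
    \<comment> \<open>Every nonzero \<open>u\<close> has a positive product with some signed basis
      vector, which turns the weak inequality for a point of \<open>S i\<close> into the strict one
      that \<open>colourful_cone\<close> asks for.\<close>
    define W :: "(real ^ 'n) set" where "W = Basis \<union> uminus ` Basis"
    have W: "norm w = 1" if "w \<in> W" for w
      using that by (auto simp: W_def)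
    define Y where "Y = (\<lambda>i. (\<lambda>(s, w). s - p + (d / 2) *\<^sub>R w) ` (S i \<times> W))"
    have "finite (Y i)" for i
      unfolding Y_def W_def using S(1) by auto
    moreover have "\<exists>y\<in>Y i. u \<bullet> y > 0" if u: "u \<noteq> 0" for i u
    proof -
      have "\<exists>s\<in>S i. u \<bullet> s \<ge> u \<bullet> p"
      proof (rule ccontr)
        assume "\<not> ?thesis"
        then have "S i \<subseteq> {x. u \<bullet> x < u \<bullet> p}" by force
        then have "convex hull (S i) \<subseteq> {x. u \<bullet> x < u \<bullet> p}"
          by (rule hull_minimal) (rule convex_halfspace_lt)
        with S(3)[of i] show False by auto
      qed
      then obtain s where s: "s \<in> S i" "u \<bullet> s \<ge> u \<bullet> p" by blast
      obtain b where b: "b \<in> Basis" "u \<bullet> b \<noteq> 0"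
        using u euclidean_all_zero_iff[of u] by blast
      have "\<exists>w\<in>W. u \<bullet> w > 0"
      proof (cases "u \<bullet> b > 0")
        case True
        with b show ?thesis unfolding W_def by blast
      next
        case False
        with b show ?thesis unfolding W_def by (intro bexI[of _ "- b"]) auto
      qed
      then obtain w where w: "w \<in> W" "u \<bullet> w > 0" by blast
      have "u \<bullet> (s - p + (d / 2) *\<^sub>R w) > 0"
        using s(2) w(2) \<open>d > 0\<close> by (simp add: inner_add_right inner_diff_right add_nonneg_pos)
      moreover have "s - p + (d / 2) *\<^sub>R w \<in> Y i"
        unfolding Y_def using s(1) w(1) by (auto intro: image_eqI[of _ _ "(s, w)"])
      ultimately show ?thesis by blast
    qed
    ultimately obtain y where y: "\<And>i. y i \<in> Y i" "p - a \<in> convex_cone hull (range y)"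
      using colourful_cone[of Y "p - a"] by metis
    have "\<forall>i. \<exists>s w. s \<in> S i \<and> w \<in> W \<and> y i = s - p + (d / 2) *\<^sub>R w"
      using y(1) unfolding Y_def by fastforce
    then obtain s w where sw: "\<And>i. s i \<in> S i" "\<And>i. w i \<in> W"
        "\<And>i. y i = s i - p + (d / 2) *\<^sub>R w i"
      by metis
    obtain l where l: "\<And>i. 0 \<le> l i" "p - a = (\<Sum>i\<in>UNIV. l i *\<^sub>R y i)"
      using convex_cone_hull_rangeE[OF y(2)] by metis
    define L where "L = 1 + (\<Sum>i\<in>UNIV. l i)"
    have L: "L > 0" unfolding L_def using l(1) by (simp add: add_pos_nonneg sum_nonneg)
    \<comment> \<open>\<open>c\<close> is the combination with the perturbations removed and
      \<open>e\<close> is their weighted sum. Then \<open>p - c\<close> is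
      \<open>d / (2 * L)\<close> times \<open>e\<close>, and the norm of \<open>e\<close> is at most
      \<open>L\<close>, so \<open>c\<close> is within \<open>d / 2\<close> of
      \<open>p\<close>.\<close>
    define c where "c = (1 / L) *\<^sub>R a + (\<Sum>i\<in>UNIV. (l i / L) *\<^sub>R s i)"
    define e where "e = (\<Sum>i\<in>UNIV. l i *\<^sub>R w i)"
    have c: "c \<in> ?H s"
    proof -
      \<comment> \<open>The option type indexes the points with \<open>None\<close> for
        \<open>a\<close>, so coinciding points cause no trouble.\<close>
      let ?g = "\<lambda>o'. case o' of None \<Rightarrow> a | Some i \<Rightarrow> s i"
      let ?l = "\<lambda>o'. case o' of None \<Rightarrow> 1 / L | Some i \<Rightarrow> l i / L"
      have "(\<Sum>j\<in>UNIV. ?l j *\<^sub>R ?g j) \<in> ?H s"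
      proof (rule convex_sum)
        show "(\<Sum>j\<in>UNIV. ?l j) = 1"
          using L by (simp add: UNIV_option_conv sum.reindex flip: sum_divide_distrib add_divide_distrib)
            (simp add: L_def)
      qed (use L l(1) in \<open>auto split: option.splits intro: hull_inc\<close>)
      then show ?thesis by (simp add: UNIV_option_conv sum.reindex c_def)
    qed
    have "p - a = (\<Sum>i\<in>UNIV. l i *\<^sub>R s i) - (\<Sum>i\<in>UNIV. l i) *\<^sub>R p + (d / 2) *\<^sub>R e"
      unfolding l(2) sw(3) e_def
      by (simp add: algebra_simps sum.distrib sum_subtractf scaleR_sum_right scaleR_sum_left)
    then have "L *\<^sub>R p = a + (\<Sum>i\<in>UNIV. l i *\<^sub>R s i) + (d / 2) *\<^sub>R e"
      unfolding L_def by (simp add: algebra_simps)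
    moreover have "L *\<^sub>R c = a + (\<Sum>i\<in>UNIV. l i *\<^sub>R s i)"
      using L by (simp add: c_def scaleR_add_right scaleR_sum_right)
    ultimately have "L *\<^sub>R (p - c) = (d / 2) *\<^sub>R e" by (simp add: scaleR_diff_right)
    then have "L * norm (p - c) = d / 2 * norm e"
      using L \<open>d > 0\<close> by (metis abs_of_pos half_gt_zero norm_scaleR)
    also have "norm e \<le> (\<Sum>i\<in>UNIV. l i)"
      unfolding e_def by (rule sum_norm_le) (use l(1) W[OF sw(2)] in simp)
    then have "d / 2 * norm e \<le> d / 2 * L"
      using \<open>d > 0\<close> by (simp add: L_def)
    finally have "norm (p - c) \<le> d / 2"
      using L by (simp add: mult.commute)
    moreover have "d \<le> dist p c"
      using dmin[of s] infdist_le[OF c, of p] sw(1) by force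
    ultimately show False using \<open>d > 0\<close> by (simp add: dist_norm)
  qed
  with S(2) that show thesis by (metis PiE_mem UNIV_I subsetD)
qed

section \<open>Uniform polytope approximation and attainment of the minimum\<close>

text \<open>If \<open>z\<close> lies outside \<open>P\<close>, separate it by a hyperplane and push
  it by \<delta> along the normal away from \<open>P\<close>. The new point is still in the ball of
  radius \<open>r\<close>, but farther than \<delta> from \<open>P\<close>.\<close>

lemma cball_subset_of_cball_subset_sum:
  fixes P :: "'a::euclidean_space set"
  assumes "convex P" "closed P" and sub: "\<And>w. norm w \<le> r \<Longrightarrow> \<exists>x\<in>P. norm (w - x) \<le> \<delta>"
    and "0 \<le> \<delta>" "\<delta> \<le> r"
  shows "cball 0 (r - \<delta>) \<subseteq> P"
proof
  fix z :: 'a assume z: "z \<in> cball 0 (r - \<delta>)"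
  show "z \<in> P"
  proof (rule ccontr)
    assume "z \<notin> P"
    then obtain a b where ab: "a \<bullet> z < b" "\<And>x. x \<in> P \<Longrightarrow> a \<bullet> x > b"
      using separating_hyperplane_closed_point[OF assms(1,2)] by blast
    obtain x0 where "x0 \<in> P" using sub[of 0] assms by force
    with ab have "a \<noteq> 0" by force
    define w where "w = z - (\<delta> / norm a) *\<^sub>R a"
    have "norm w \<le> norm z + norm ((\<delta> / norm a) *\<^sub>R a)"
      unfolding w_def by (rule norm_triangle_ineq4)
    also have "norm ((\<delta> / norm a) *\<^sub>R a) = \<delta>" using \<open>a \<noteq> 0\<close> \<open>0 \<le> \<delta>\<close> by simp
    finally have "norm w \<le> r" using z by simp
    then obtain x where x: "x \<in> P" "norm (w - x) \<le> \<delta>" using sub by blast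
    have "a \<bullet> w = a \<bullet> z - \<delta> * norm a"
      using \<open>a \<noteq> 0\<close> by (simp add: w_def inner_diff_right power2_norm_eq_inner[symmetric] power2_eq_square)
    moreover have "a \<bullet> (x - w) \<le> norm a * norm (w - x)"
      using norm_cauchy_schwarz[of a "x - w"] by (simp add: norm_minus_commute)
    then have "a \<bullet> (x - w) \<le> \<delta> * norm a"
      using mult_left_mono[OF x(2) norm_ge_zero[of a]] by (simp add: mult.commute)
    ultimately have "a \<bullet> x \<le> a \<bullet> z" by (simp add: inner_diff_right)
    with ab(1) ab(2)[OF x(1)] show False by simp
  qed
qed

text \<open>The vertices are points of \<open>L\<close> near the members of a net of the large ball.
  The net depends on \<open>r\<close>, \<open>R\<close> and \<epsilon> only, so the bound is uniform
  in \<open>L\<close>.\<close>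

lemma polytope_approximation_between_balls:
  fixes r R \<epsilon> :: real
  assumes "0 < r" "0 < \<epsilon>"
  obtains n where "\<And>L :: 'a::euclidean_space set. convex L \<Longrightarrow> cball 0 r \<subseteq> L \<Longrightarrow> L \<subseteq> cball 0 R \<Longrightarrow>
    \<exists>P. polytope P \<and> card {v. v extreme_point_of P} \<le> n \<and> P \<subseteq> L \<and> L \<subseteq> (\<lambda>x. (1 + \<epsilon>) *\<^sub>R x) ` P"
proof -
  \<comment> \<open>The solution of \<delta> = \<epsilon> (r - \<delta>): an error of length
    \<delta> is then \<epsilon> times a vector of the ball of radius \<open>r - \<delta>\<close>,
    which will lie in \<open>P\<close>.\<close>
  define \<delta> where "\<delta> = r * \<epsilon> / (1 + \<epsilon>)"
  have \<delta>: "0 < \<delta>" "\<delta> \<le> r" "\<delta> = \<epsilon> * (r - \<delta>)"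
    using assms by (auto simp: \<delta>_def field_simps)
  obtain C where C: "finite C" "cball (0::'a) R \<subseteq> (\<Union>c\<in>C. ball c (\<delta> / 2))"
    using seq_compact_imp_totally_bounded[of "cball (0::'a) R"] \<delta>(1)
    by (metis compact_cball compact_imp_seq_compact half_gt_zero)
  show thesis
  proof (rule that[of "card C"])
    fix L :: "'a set"
    assume L: "convex L" "cball 0 r \<subseteq> L" "L \<subseteq> cball 0 R"
    \<comment> \<open>Net points may lie outside \<open>L\<close>; those whose small ball meets
      \<open>L\<close> are replaced by a point of \<open>L\<close> in that ball.\<close>
    define D where "D = {c\<in>C. ball c (\<delta> / 2) \<inter> L \<noteq> {}}"
    define s where "s = (\<lambda>c. SOME x. x \<in> ball c (\<delta> / 2) \<inter> L)"
    have s: "s c \<in> ball c (\<delta> / 2) \<inter> L" if "c \<in> D" for c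
      unfolding s_def by (rule someI_ex) (use that in \<open>auto simp: D_def\<close>)
    define P where "P = convex hull (s ` D)"
    have finD: "finite D" using C(1) by (simp add: D_def)
    have "polytope P" unfolding P_def polytope_def using finD by blast
    have "card {v. v extreme_point_of P} \<le> card (s ` D)"
      unfolding P_def by (rule card_mono) (use finD extreme_points_of_convex_hull in auto)
    also have "\<dots> \<le> card D" using finD by (rule card_image_le)
    also have "\<dots> \<le> card C" using C(1) by (intro card_mono) (auto simp: D_def)
    finally have card: "card {v. v extreme_point_of P} \<le> card C" .
    have PL: "P \<subseteq> L" unfolding P_def by (rule hull_minimal) (use s L(1) in auto)
    have near: "\<exists>x\<in>P. norm (w - x) \<le> \<delta>" if w: "w \<in> L" for w
    proof -
      obtain c where c: "c \<in> C" "w \<in> ball c (\<delta> / 2)" using w L(3) C(2) by blast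
      with w have "c \<in> D" by (auto simp: D_def)
      then have "s c \<in> P" unfolding P_def by (intro hull_inc) auto
      moreover have "dist c (s c) < \<delta> / 2" using s[OF \<open>c \<in> D\<close>] by simp
      then have "dist w (s c) < \<delta>" using c(2) dist_triangle_half_r[of c w \<delta> "s c"] by simp
      ultimately show ?thesis by (auto simp: dist_norm intro: less_imp_le)
    qed
    have "convex P" by (simp add: P_def)
    have ball: "cball 0 (r - \<delta>) \<subseteq> P"
    proof (rule cball_subset_of_cball_subset_sum)
      show "closed P" using \<open>polytope P\<close> by (rule polytope_imp_closed)
      show "\<exists>x\<in>P. norm (w - x) \<le> \<delta>" if "norm w \<le> r" for w
        using near that L(2) by auto
    qed (use \<delta> \<open>convex P\<close> in auto)
    have "L \<subseteq> (\<lambda>x. (1 + \<epsilon>) *\<^sub>R x) ` P"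
    proof
      fix w assume "w \<in> L"
      then obtain p where p: "p \<in> P" "norm (w - p) \<le> \<delta>" using near by blast
      \<comment> \<open>Now \<open>w\<close> is \<open>p\<close> plus \<epsilon> times
        \<open>y\<close> with both points in \<open>P\<close>, so \<open>w\<close> divided by 1 +
        \<epsilon> is a convex combination of them.\<close>
      define y where "y = (1 / \<epsilon>) *\<^sub>R (w - p)"
      have "norm y \<le> r - \<delta>"
        using p(2) \<delta>(3) \<open>0 < \<epsilon>\<close> by (simp add: y_def divide_le_eq mult.commute)
      then have "y \<in> P" using ball by auto
      have "(1 / (1 + \<epsilon>)) *\<^sub>R p + (\<epsilon> / (1 + \<epsilon>)) *\<^sub>R y \<in> P"
        using \<open>convex P\<close> p(1) \<open>y \<in> P\<close> \<open>0 < \<epsilon>\<close> by (intro convexD) (auto simp: field_simps)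
      moreover have "w = (1 + \<epsilon>) *\<^sub>R ((1 / (1 + \<epsilon>)) *\<^sub>R p + (\<epsilon> / (1 + \<epsilon>)) *\<^sub>R y)"
        using \<open>0 < \<epsilon>\<close> by (simp add: scaleR_add_right y_def)
      ultimately show "w \<in> (\<lambda>x. (1 + \<epsilon>) *\<^sub>R x) ` P" by blast
    qed
    with \<open>polytope P\<close> card PL
    show "\<exists>P. polytope P \<and> card {v. v extreme_point_of P} \<le> card C \<and> P \<subseteq> L \<and>
        L \<subseteq> (\<lambda>x. (1 + \<epsilon>) *\<^sub>R x) ` P" by blast
  qed
qed

text \<open>Take as new coordinate vectors a family in \<open>K\<close> of maximal absolute
  determinant. Then \<open>K\<close> contains their cross-polytope, and maximality bounds all
  coordinates of points of \<open>K\<close> by 1. The two radii are crude bounds for the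
  cross-polytope and the cube.\<close>

lemma auerbach_position:
  fixes K :: "(real ^ 'n::finite) set"
  assumes "compact K" "convex K" and sym: "\<And>x. x \<in> K \<Longrightarrow> - x \<in> K" and "interior K \<noteq> {}"
  obtains f :: "real ^ 'n \<Rightarrow> real ^ 'n" where "linear f" "bij f"
    "cball 0 (1 / CARD('n)) \<subseteq> f ` K" "f ` K \<subseteq> cball 0 (CARD('n))"
proof -
  obtain c e where ce: "e > 0" "cball c e \<subseteq> K"
    using assms(4) mem_interior_cball by blast
  \<comment> \<open>Such a \<open>y\<close> is the midpoint of \<open>c + 2 *\<^sub>R y\<close> and
    \<open>- c\<close>.\<close>
  have small: "y \<in> K" if "norm y \<le> e / 2" for y
  proof -
    have "c + 2 *\<^sub>R y \<in> K" using ce that by (auto simp: dist_norm)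
    moreover have "- c \<in> K" using ce by (intro sym) auto
    ultimately have "(1 / 2) *\<^sub>R (c + 2 *\<^sub>R y) + (1 / 2) *\<^sub>R (- c) \<in> K"
      using \<open>convex K\<close> by (intro convexD) auto
    then show ?thesis by (simp add: scaleR_add_right)
  qed
  have "0 \<in> K" using small[of 0] ce by simp
  define M where "M = {A :: real ^ 'n ^ 'n. \<forall>i. A $ i \<in> K}"
  have "closed M"
    unfolding M_def using closed_vector_box[of "\<lambda>_. K"] \<open>compact K\<close> compact_imp_closed by blast
  moreover have "bounded M"
  proof -
    obtain b where b: "\<And>x. x \<in> K \<Longrightarrow> norm x \<le> b"
      using \<open>compact K\<close> compact_imp_bounded bounded_iff by metis
    have "norm A \<le> of_nat CARD('n) * b" if "A \<in> M" for A
    proof -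
      have "norm A \<le> (\<Sum>i\<in>UNIV. norm (A $ i))"
        unfolding norm_vec_def by (rule L2_set_le_sum) simp
      also have "\<dots> \<le> (\<Sum>i\<in>(UNIV::'n set). b)"
        by (rule sum_mono) (use that b in \<open>auto simp: M_def\<close>)
      finally show ?thesis by simp
    qed
    then show ?thesis unfolding bounded_iff by blast
  qed
  ultimately have "compact M" by (simp add: compact_eq_bounded_closed)
  \<comment> \<open>A nonsingular competitor, so that the maximal determinant is not 0.\<close>
  define A0 :: "real ^ 'n ^ 'n" where "A0 = (\<chi> i. axis i (e / 2))"
  have A0: "A0 \<in> M" unfolding M_def A0_def using ce
    by (auto intro!: small simp: norm_eq_sqrt_inner inner_axis_axis real_sqrt_divide)
  have "det A0 = (\<Prod>i\<in>UNIV. A0 $ i $ i)"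
    by (rule det_diagonal) (simp add: A0_def axis_def)
  then have "det A0 \<noteq> 0" using ce by (simp add: A0_def axis_def)
  have "continuous_on M (\<lambda>A. \<bar>det A\<bar>)"
    unfolding det_def by (intro continuous_intros)
  then obtain A where A: "A \<in> M" "\<And>B. B \<in> M \<Longrightarrow> \<bar>det B\<bar> \<le> \<bar>det A\<bar>"
    using continuous_attains_sup[OF \<open>compact M\<close>] A0 by blast
  have "det A \<noteq> 0" using A(2)[OF A0] \<open>det A0 \<noteq> 0\<close> by auto
  define g where "g = (\<lambda>x. transpose A *v x)"
  have g: "linear g" unfolding g_def by simp
  have "invertible (transpose A)"
    using \<open>det A \<noteq> 0\<close> by (simp add: invertible_det_nz)
  then have "bij g" unfolding g_def by (simp add: invertible_eq_bij)
  have g_sum: "g x = (\<Sum>i\<in>UNIV. x $ i *s row i A)" for x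
    unfolding g_def matrix_mult_sum by simp
  have rowK: "row i A \<in> K" for i using A(1) by (simp add: M_def row_def)
  have lo: "g x \<in> K" if "norm x \<le> 1 / CARD('n)" for x
  proof -
    have "(real CARD('n) * x $ i) *\<^sub>R row i A \<in> K" for i
    proof -
      let ?t = "real CARD('n) * x $ i"
      have "\<bar>x $ i\<bar> \<le> 1 / CARD('n)" using component_le_norm_cart[of x i] that by simp
      then have t: "\<bar>?t\<bar> \<le> 1" by (simp add: abs_mult field_simps)
      have "((1 + ?t) / 2) *\<^sub>R row i A + ((1 - ?t) / 2) *\<^sub>R (- row i A) \<in> K"
        by (intro convexD[OF \<open>convex K\<close>] rowK sym) (use t in \<open>auto simp: field_simps\<close>)
      also have "((1 + ?t) / 2) *\<^sub>R row i A + ((1 - ?t) / 2) *\<^sub>R (- row i A)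
          = ((1 + ?t) / 2 - (1 - ?t) / 2) *\<^sub>R row i A"
        by (simp only: scaleR_left_diff_distrib scaleR_minus_right add_uminus_conv_diff)
      also have "(1 + ?t) / 2 - (1 - ?t) / 2 = ?t" by (simp add: field_simps)
      finally show ?thesis .
    qed
    \<comment> \<open>\<open>g x\<close> is the average of the \<open>CARD('n)\<close> points just
      shown to lie in \<open>K\<close>.\<close>
    then have "(\<Sum>i\<in>(UNIV::'n set). (1 / CARD('n)) *\<^sub>R ((real CARD('n) * x $ i) *\<^sub>R row i A)) \<in> K"
      by (intro convex_sum \<open>convex K\<close>) auto
    then show ?thesis by (simp add: g_sum scalar_mult_eq_scaleR)
  qed
  have hi: "norm x \<le> CARD('n)" if "g x \<in> K" for x
  proof -
    have "\<bar>x $ k\<bar> \<le> 1" for k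
    proof -
      \<comment> \<open>By Cramer's rule, replacing row \<open>k\<close> by \<open>g x\<close>
        multiplies the determinant by \<open>x $ k\<close>.\<close>
      let ?B = "(\<chi> i. if i = k then g x else row i A) :: real ^ 'n ^ 'n"
      have "?B \<in> M" unfolding M_def using that rowK by simp
      moreover have "det ?B = x $ k * det A"
        unfolding g_sum by (rule cramer_lemma_transpose)
      ultimately have "\<bar>x $ k\<bar> * \<bar>det A\<bar> \<le> \<bar>det A\<bar>" using A(2)[of ?B] by (simp add: abs_mult)
      then show ?thesis using \<open>det A \<noteq> 0\<close> by simp
    qed
    then have "(\<Sum>i\<in>UNIV. \<bar>x $ i\<bar>) \<le> (\<Sum>i\<in>(UNIV::'n set). 1)" by (intro sum_mono)
    with norm_le_l1_cart[of x] show ?thesis by simp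
  qed
  have img: "inv g ` K = {x. g x \<in> K}"
    using bij_vimage_eq_inv_image[OF \<open>bij g\<close>, of K] by auto
  show thesis
  proof (rule that[of "inv g"])
    show "linear (inv g)" using g \<open>bij g\<close> by (simp add: inj_linear_imp_inv_linear bij_is_inj)
    show "bij (inv g)" using \<open>bij g\<close> by (rule bij_imp_bij_inv)
  qed (use lo hi img in auto)
qed

lemma n_bms_approximation:
  fixes K :: "(real ^ 'n::finite) set"
  assumes "\<epsilon> > 0" "smooth_symmetric_body K"
  obtains P :: "(real ^ 'n) set" and f :: "real ^ 'n \<Rightarrow> real ^ 'n"
  where "polytope P" "card {v. v extreme_point_of P} \<le> n_bms TYPE('n) \<epsilon>" "linear f" "bij f"
    "P \<subseteq> f ` K" "f ` K \<subseteq> (\<lambda>x. (1 + \<epsilon>) *\<^sub>R x) ` P"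
proof -
  let ?Q = "\<lambda>n. \<forall>K :: (real ^ 'n) set. smooth_symmetric_body K \<longrightarrow>
      (\<exists>(P :: (real ^ 'n) set) (f :: real ^ 'n \<Rightarrow> real ^ 'n).
         polytope P \<and> card {v. v extreme_point_of P} \<le> n \<and>
         linear f \<and> bij f \<and>
         P \<subseteq> f ` K \<and> f ` K \<subseteq> (\<lambda>x. (1 + \<epsilon>) *\<^sub>R x) ` P)"
  have "0 < 1 / real CARD('n)" by simp
  then obtain n where n: "\<And>L :: (real ^ 'n) set. convex L \<Longrightarrow> cball 0 (1 / CARD('n)) \<subseteq> L \<Longrightarrow>
      L \<subseteq> cball 0 (CARD('n)) \<Longrightarrow>
      \<exists>P. polytope P \<and> card {v. v extreme_point_of P} \<le> n \<and> P \<subseteq> L \<and> L \<subseteq> (\<lambda>x. (1 + \<epsilon>) *\<^sub>R x) ` P"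
    using polytope_approximation_between_balls[OF _ assms(1), where 'a = "real ^ 'n"] by metis
  have "?Q n"
  proof (intro allI impI)
    fix K :: "(real ^ 'n) set"
    assume "smooth_symmetric_body K"
    then have K: "compact K" "convex K" "\<And>x. x \<in> K \<Longrightarrow> - x \<in> K" "measure lebesgue K > 0"
      by (auto simp: smooth_symmetric_body_def)
    \<comment> \<open>A convex set with empty interior is negligible, contrary to the positive
      volume.\<close>
    have "interior K \<noteq> {}"
      using K(2,4) negligible_convex_interior[OF K(2)] negligible_imp_measure0[of K] by auto
    then obtain f :: "real ^ 'n \<Rightarrow> real ^ 'n" where f: "linear f" "bij f"
        "cball 0 (1 / CARD('n)) \<subseteq> f ` K" "f ` K \<subseteq> cball 0 (CARD('n))"
      using auerbach_position[OF K(1-3)] by metis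
    have "convex (f ` K)" using f(1) K(2) by (rule convex_linear_image)
    from n[OF this f(3,4)] f(1,2)
    show "\<exists>(P :: (real ^ 'n) set) (f :: real ^ 'n \<Rightarrow> real ^ 'n).
         polytope P \<and> card {v. v extreme_point_of P} \<le> n \<and>
         linear f \<and> bij f \<and>
         P \<subseteq> f ` K \<and> f ` K \<subseteq> (\<lambda>x. (1 + \<epsilon>) *\<^sub>R x) ` P" by blast
  qed
  then have "?Q (n_bms TYPE('n) \<epsilon>)" unfolding n_bms_def by (rule LeastI)
  with assms(2) that show thesis by blast
qed

section \<open>Approximation of the unit ball\<close>

lemma smooth_symmetric_body_cball: "smooth_symmetric_body (cball (0 :: 'a::euclidean_space) 1)"
proof -
  have "measure lebesgue (cball (0::'a) 1) > 0"
    by (simp add: content_cball_pos measure_completion)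
  moreover have "C2_boundary (cball (0::'a) 1)"
    unfolding C2_boundary_def
  proof (intro ballI exI conjI)
    \<comment> \<open>One neighbourhood serves all boundary points: away from the origin the
      gradient of \<open>x \<bullet> x - 1\<close> does not vanish.\<close>
    let ?U = "- {0::'a}"
    show "open ?U" by (simp add: open_Compl)
    show "p \<in> ?U" if "p \<in> frontier (cball (0::'a) 1)" for p using that by auto
    show "C2_on ?U (\<lambda>x. x \<bullet> x - 1) (\<lambda>x. 2 *\<^sub>R x) (\<lambda>x. 2 *\<^sub>R id_blinfun)"
      unfolding C2_on_def
    proof (intro conjI ballI)
      fix x :: 'a
      show "GDERIV (\<lambda>x. x \<bullet> x - 1) x :> 2 *\<^sub>R x"
        unfolding gderiv_def
        by (auto intro!: derivative_eq_intros simp: inner_commute)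
      show "((*\<^sub>R) 2 has_derivative blinfun_apply (2 *\<^sub>R id_blinfun)) (at x)"
        by (auto intro!: derivative_eq_intros simp: scaleR_blinfun.rep_eq)
    qed simp
    show "\<And>x. x \<in> ?U \<Longrightarrow> 2 *\<^sub>R x \<noteq> 0" by simp
    show "frontier (cball (0::'a) 1) \<inter> ?U = {x \<in> ?U. x \<bullet> x - 1 = 0}"
      by (auto simp: norm_eq_1)
  qed
  ultimately show ?thesis by (simp add: smooth_symmetric_body_def)
qed

text \<open>Applying the inverse of the linear map to the vertices of the polytope removes that map,
  since inclusions and convex hulls are preserved.\<close>

lemma ball_approximation:
  assumes "\<epsilon> > 0"
  obtains V :: "(real ^ 'n::finite) set" where "finite V" "card V \<le> n_bms TYPE('n) \<epsilon>"
    "V \<subseteq> cball 0 1" "cball 0 (1 / (1 + \<epsilon>)) \<subseteq> convex hull V"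
proof -
  obtain P :: "(real ^ 'n) set" and f :: "real ^ 'n \<Rightarrow> real ^ 'n"
    where P: "polytope P" "card {v. v extreme_point_of P} \<le> n_bms TYPE('n) \<epsilon>" "linear f" "bij f"
      "P \<subseteq> f ` cball 0 1" "f ` cball 0 1 \<subseteq> (\<lambda>x. (1 + \<epsilon>) *\<^sub>R x) ` P"
    using n_bms_approximation[OF assms smooth_symmetric_body_cball, where 'n = 'n] by metis
  define E where "E = {v. v extreme_point_of P}"
  have E: "finite E" "E \<subseteq> P"
    unfolding E_def using finite_polyhedron_extreme_points[OF polytope_imp_polyhedron[OF P(1)]]
    by (auto simp: extreme_point_of_def)
  have hull: "convex hull E = P"
    unfolding E_def using P(1) Krein_Milman_polytope unfolding polytope_def by metis
  have lin: "linear (inv f)"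
    using P(3,4) by (simp add: inj_linear_imp_inv_linear bij_is_inj)
  have inv: "inv f (f x) = x" for x using P(4) by (simp add: bij_is_inj inv_f_f)
  show thesis
  proof (rule that[of "inv f ` E"])
    show "finite (inv f ` E)" using E by simp
    show "card (inv f ` E) \<le> n_bms TYPE('n) \<epsilon>"
      using card_image_le[OF E(1), of "inv f"] P(2) unfolding E_def by linarith
    show "inv f ` E \<subseteq> cball 0 1" using E(2) P(5) inv by force
    show "cball 0 (1 / (1 + \<epsilon>)) \<subseteq> convex hull (inv f ` E)"
    proof
      fix x :: "real ^ 'n" assume x: "x \<in> cball 0 (1 / (1 + \<epsilon>))"
      have "(1 + \<epsilon>) *\<^sub>R x \<in> cball 0 1" using x assms by (simp add: le_divide_eq mult.commute)
      then obtain p where p: "p \<in> P" "f ((1 + \<epsilon>) *\<^sub>R x) = (1 + \<epsilon>) *\<^sub>R p" using P(6) by blast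
      then have "f x = p" using P(3) assms by (simp add: linear_scale)
      then have "x \<in> inv f ` P" using p(1) inv by (metis image_eqI)
      then show "x \<in> convex hull (inv f ` E)"
        by (simp only: hull flip: convex_hull_linear_image[OF lin])
    qed
  qed
qed

section \<open>Choice of the points \<open>x i\<close>\<close>

text \<open>In a convex combination representing 0, the term with \<open>t *\<^sub>R a\<close> is a
  nonnegative multiple of \<open>a\<close>. Renormalising the weights puts 0 in \<open>H\<close>,
  and \<open>t *\<^sub>R a\<close> lies on the segment from 0 to \<open>a\<close>.\<close>

lemma mem_of_scaled_generator:
  fixes W :: "'a::real_vector set"
  assumes "convex H" "0 \<in> convex hull (insert (t *\<^sub>R a) W)" "a \<noteq> 0" "0 < t" "t \<le> 1"
    and "a \<in> H" "W \<subseteq> H"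
  shows "t *\<^sub>R a \<in> H"
proof -
  have "W \<noteq> {}" using assms(2-4) by auto
  then obtain \<alpha> \<beta> y where y: "0 \<le> \<alpha>" "0 \<le> \<beta>" "\<alpha> + \<beta> = 1" "y \<in> convex hull W"
      "0 = \<alpha> *\<^sub>R t *\<^sub>R a + \<beta> *\<^sub>R y"
    using assms(2) unfolding convex_hull_insert[OF \<open>W \<noteq> {}\<close>] by auto
  have "y \<in> H" using y(4) assms(1,7) hull_minimal[of W H convex] by blast
  define s where "s = \<alpha> * t + \<beta>"
  have "s > 0" unfolding s_def using y(1-3) \<open>0 < t\<close>
    by (cases "\<alpha> = 0") (auto intro: add_pos_nonneg)
  have "(\<alpha> * t / s) *\<^sub>R a + (\<beta> / s) *\<^sub>R y \<in> H"
    using y(1,2) \<open>0 < t\<close> \<open>s > 0\<close>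
    by (intro convexD[OF assms(1)] assms(6) \<open>y \<in> H\<close>) (auto simp: s_def simp flip: add_divide_distrib)
  also have "(\<alpha> * t / s) *\<^sub>R a + (\<beta> / s) *\<^sub>R y = (1 / s) *\<^sub>R (\<alpha> *\<^sub>R t *\<^sub>R a + \<beta> *\<^sub>R y)"
    by (simp add: scaleR_add_right)
  finally have "0 \<in> H" using y(5) by simp
  then have "t *\<^sub>R a + (1 - t) *\<^sub>R 0 \<in> H"
    using assms by (intro convexD[OF assms(1)]) auto
  then show ?thesis by simp
qed

theorem theorem2p5:
  fixes \<epsilon> :: real and n N :: nat and X :: "nat \<Rightarrow> (real ^ 'n) set"
  assumes "\<epsilon> > 0"
    and "n = n_bms TYPE('n) \<epsilon>"
    and "N = (n - 1) * CARD('n) + 1"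
    and "cball 0 1 \<subseteq> (\<Inter>i\<in>{1..N}. convex hull (X i))"
  shows "\<exists>x. (\<forall>i\<in>{1..N}. x i \<in> X i) \<and>
    cball 0 (1 / (1 + \<epsilon>)) \<subseteq> convex hull (x ` {1..N})"
proof -
  have X: "cball 0 1 \<subseteq> convex hull (X i)" if "i \<in> {1..N}" for i
    using assms(4) that by blast
  have "1 \<in> {1..N}" using assms(3) by simp
  obtain a where a: "a \<in> X 1" "norm a \<ge> 1"
  proof -
    obtain e :: "real ^ 'n" where e: "norm e = 1" using vector_choose_size[of 1] by auto
    \<comment> \<open>The unit vector \<open>e\<close> is in the hull of \<open>X 1\<close>, so
      \<open>X 1\<close> cannot lie strictly below the tangent hyperplane of the ball at
      \<open>e\<close>.\<close>
    have "\<exists>a\<in>X 1. e \<bullet> a \<ge> 1"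
    proof (rule ccontr)
      assume "\<not> ?thesis"
      then have "X 1 \<subseteq> {x. e \<bullet> x < 1}" by force
      then have "convex hull (X 1) \<subseteq> {x. e \<bullet> x < 1}"
        by (rule hull_minimal) (rule convex_halfspace_lt)
      moreover have "e \<in> convex hull (X 1)" using X[OF \<open>1 \<in> {1..N}\<close>] e by auto
      ultimately show False using e by (auto simp: norm_eq_1)
    qed
    then obtain a where "a \<in> X 1" "e \<bullet> a \<ge> 1" by blast
    then show ?thesis using that[of a] norm_cauchy_schwarz[of e a] e by simp
  qed
  then have "a \<noteq> 0" by auto
  obtain V :: "(real ^ 'n) set" where V: "finite V" "card V \<le> n"
      "V \<subseteq> cball 0 1" "cball 0 (1 / (1 + \<epsilon>)) \<subseteq> convex hull V"
    using ball_approximation[OF assms(1)] assms(2) by metis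
  have "\<exists>v\<in>V. v \<noteq> 0"
  proof (rule ccontr)
    assume "\<not> ?thesis"
    then have "convex hull V \<subseteq> {0}" by (intro hull_minimal) auto
    moreover obtain e :: "real ^ 'n" where "norm e = 1 / (1 + \<epsilon>)"
      using vector_choose_size[of "1 / (1 + \<epsilon>)"] assms(1) by auto
    moreover from this have "e \<in> cball 0 (1 / (1 + \<epsilon>))" by simp
    ultimately have "norm (0 :: real ^ 'n) = 1 / (1 + \<epsilon>)" using V(4) by blast
    then show False using assms(1) by simp
  qed
  then obtain v where v: "v \<in> V" "v \<noteq> 0" by blast
  \<comment> \<open>The ratio is at most 1 because \<open>v\<close> lies in the unit ball and
    \<open>a\<close> has norm at least 1. A rotation can then take \<open>v\<close> to
    \<open>t *\<^sub>R a\<close>.\<close>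
  define t where "t = norm v / norm a"
  have t: "0 < t" "t \<le> 1" using v a(2) \<open>a \<noteq> 0\<close> V(3) by (auto simp: t_def divide_le_eq)
  have "norm v = norm (t *\<^sub>R a)" using \<open>a \<noteq> 0\<close> by (simp add: t_def)
  then obtain R where R: "orthogonal_transformation R" "R v = t *\<^sub>R a"
    using orthogonal_transformation_exists by metis
  define W where "W = R ` (V - {v})"
  have RV: "R ` V = insert (t *\<^sub>R a) W"
    using v(1) unfolding W_def R(2)[symmetric] by (metis image_insert insert_Diff)
  have W: "W \<subseteq> cball 0 1"
    using V(3) R(1) by (auto simp: W_def orthogonal_transformation_norm)
  have "finite W" using V(1) by (simp add: W_def)
  have "card W \<le> n - 1"
    using card_image_le[of "V - {v}" R] V(1,2) v(1) by (simp add: W_def)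
  have hullW: "cball 0 (1 / (1 + \<epsilon>)) \<subseteq> convex hull (insert (t *\<^sub>R a) W)"
  proof -
    have "R ` cball 0 (1 / (1 + \<epsilon>)) \<subseteq> R ` (convex hull V)" using V(4) by (rule image_mono)
    moreover have lin: "linear R" using R(1) by (rule orthogonal_transformation_linear)
    ultimately show ?thesis
      by (simp add: image_orthogonal_transformation_cball[OF R(1)] linear_0 RV
          convex_hull_linear_image[OF lin])
  qed
  \<comment> \<open>Index 1 is reserved for \<open>a\<close>; the remaining
    \<open>(n - 1) * CARD('n)\<close> indices hold one block of \<open>CARD('n)\<close> for each
    point of \<open>W\<close>. Injectivity of \<open>h\<close> makes the blocks disjoint.\<close>
  have "card (W \<times> (UNIV :: 'n set)) \<le> card {2..N}"
    using \<open>card W \<le> n - 1\<close> assms(3) by (simp add: card_cartesian_product)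
  then obtain h :: "(real ^ 'n) \<times> 'n \<Rightarrow> nat"
    where h: "h ` (W \<times> UNIV) \<subseteq> {2..N}" "inj_on h (W \<times> UNIV)"
    using card_le_inj[of "W \<times> (UNIV :: 'n set)" "{2..N}"] \<open>finite W\<close> by auto
  have "\<exists>y. (\<forall>i. y i \<in> X (h (w, i))) \<and> w \<in> convex hull (insert a (range y))"
    if "w \<in> W" for w
  proof -
    have "w \<in> convex hull (X (h (w, i)))" for i
    proof -
      have "h (w, i) \<in> {2..N}" using h(1) that by blast
      then show ?thesis using X[of "h (w, i)"] W that by auto
    qed
    then show ?thesis using colourful_caratheodory_fixed_point[of w "\<lambda>i. X (h (w, i))" a] by metis
  qed
  then obtain y where y: "\<And>w i. w \<in> W \<Longrightarrow> y w i \<in> X (h (w, i))"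
      "\<And>w. w \<in> W \<Longrightarrow> w \<in> convex hull (insert a (range (y w)))"
    by metis
  have ne: "X i \<noteq> {}" if "i \<in> {1..N}" for i using X[OF that] by auto
  let ?g = "inv_into (W \<times> UNIV) h"
  \<comment> \<open>Indices from 2 on that lie in no block receive an arbitrary element of their
    set; extra points only enlarge the hull.\<close>
  define x where "x k = (if k = 1 then a else if k \<in> h ` (W \<times> UNIV)
      then y (fst (?g k)) (snd (?g k)) else SOME z. z \<in> X k)" for k
  have x1: "x 1 = a" by (simp add: x_def)
  have xh: "x (h (w, i)) = y w i" if "w \<in> W" for w i
  proof -
    have "h (w, i) \<in> {2..N}" using h(1) that by blast
    moreover have "?g (h (w, i)) = (w, i)" using that by (intro inv_into_f_f h(2)) auto
    ultimately show ?thesis using that by (auto simp: x_def)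
  qed
  have "x i \<in> X i" if "i \<in> {1..N}" for i
  proof (cases "i \<in> h ` (W \<times> UNIV)")
    case True
    then show ?thesis using xh y(1) by auto
  next
    case False
    then show ?thesis using a(1) ne[OF that] by (auto simp: x_def some_in_eq)
  qed
  moreover have "cball 0 (1 / (1 + \<epsilon>)) \<subseteq> convex hull (x ` {1..N})"
  proof -
    let ?H = "convex hull (x ` {1..N})"
    have "a \<in> ?H" using x1 \<open>1 \<in> {1..N}\<close> by (metis hull_inc image_eqI)
    have "W \<subseteq> ?H"
    proof
      fix w assume "w \<in> W"
      have "y w i \<in> ?H" for i
      proof -
        have "h (w, i) \<in> {2..N}" using h(1) \<open>w \<in> W\<close> by blast
        then have "h (w, i) \<in> {1..N}" by simp
        with xh[OF \<open>w \<in> W\<close>] show ?thesis by (metis hull_inc image_eqI)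
      qed
      with \<open>a \<in> ?H\<close> have "convex hull (insert a (range (y w))) \<subseteq> ?H"
        by (intro hull_minimal) auto
      with y(2)[OF \<open>w \<in> W\<close>] show "w \<in> ?H" by blast
    qed
    have "0 \<in> convex hull (insert (t *\<^sub>R a) W)" using hullW assms(1) by auto
    then have "t *\<^sub>R a \<in> ?H"
      using mem_of_scaled_generator[OF convex_convex_hull _ \<open>a \<noteq> 0\<close> t \<open>a \<in> ?H\<close> \<open>W \<subseteq> ?H\<close>] by blast
    with \<open>W \<subseteq> ?H\<close> have "convex hull (insert (t *\<^sub>R a) W) \<subseteq> ?H"
      by (intro hull_minimal) auto
    with hullW show ?thesis by blast
  qed
  ultimately show ?thesis by blast
qed

end
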